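(* Consider the Barzilai--Borwein (BB) method $x_{k+1}=x_k-\alpha_kg_k$ (with the stepsize $\alpha_k^{BB1}$) for $\min_{x\in\mathbb{R}^n}f(x)=\frac12x^{\sf T}Ax-b^{\sf T}x$, where $A\in\mathbb{R}^{n\times n}$ is symmetric positive definite and $b\in\mathbb{R}^n$. Suppose $g_{k-1},g_{k-2},g_{k-3}$ are linearly independent and let $u_k=g_{k-3}/\|g_{k-3}\|$, $v_k=\bar v_k/\|\bar v_k\|$, $r_k=\bar r_k/\|\bar r_k\|$ with $$\bar v_k=g_{k-2}-\frac{g_{k-2}^{\sf T}g_{k-3}}{\|g_{k-3}\|^2}g_{k-3},\qquad \bar r_k=g_{k-1}-\frac{g_{k-1}^{\sf T}g_{k-3}}{\|g_{k-3}\|^2}g_{k-3}-\frac{g_{k-1}^{\sf T}\bar v_k}{\|\bar v_k\|^2}\bar v_k.$$ Then the symmetric $3\times3$ matrix $H_k=(u_k,v_k,r_k)^{\sf T}A(u_k,v_k,r_k)$ has the following form: its leading $2\times2$ block is $$\hat H_k=\begin{pmatrix}\frac{1}{\alpha_{k-2}^{BB1}}&-\frac{\sqrt{1-\sigma_k}\,\|g_{k-2}\|}{\alpha_{k-3}\|g_{k-3}\|}\\ -\frac{\sqrt{1-\sigma_k}\,\|g_{k-2}\|}{\alpha_{k-3}\|g_{k-3}\|}&\frac{1}{1-\sigma_k}\left(\frac{1}{\alpha_{k-1}^{BB1}}-2\sigma_k\delta_k+\frac{\sigma_k}{\alpha_{k-2}^{BB1}}\right)\end{pmatrix},$$ its $(1,3)$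 and $(3,1)$ entries are $0$, its $(2,3)$ and $(3,2)$ entries are $$-\frac{\sqrt{g_{k-1}^{\sf T}\bar r_k}}{\alpha_{k-2}\|g_{k-2}\|\sqrt{1-\sigma_k}},$$ and its $(3,3)$ entry is $$\frac{g_{k-1}^{\sf T}A\bar r_k}{g_{k-1}^{\sf T}\bar r_k}+\frac{\gamma_k}{\alpha_{k-2}},$$ where $$\gamma_k=1-\frac{\alpha_{k-2}}{1-\sigma_k}\left(\frac{1}{\alpha_{k-1}^{BB1}}-\sigma_k\delta_k\right),\qquad \sigma_k=\left(1-\frac{\alpha_{k-3}}{\alpha_{k-2}^{BB1}}\right)\zeta_k,$$ $$\delta_k=\frac{1}{\alpha_{k-3}}\left(1-\frac{1}{\zeta_k}\right),\qquad \zeta_k=\left(1-\frac{\alpha_{k-3}}{\alpha_{k-2}^{BB1}}\right)\frac{\|g_{k-3}\|^2}{\|g_{k-2}\|^2}.$$ In addition, $$g_{k-1}^{\sf T}\bar r_k=\|g_{k-1}\|^2-\left(\sigma_k(1-\alpha_{k-2}\delta_k)^2+\gamma_k^2(1-\sigma_k)\right)\|g_{k-2}\|^2$$ and $$g_{k-1}^{\sf T}A\bar r_k=\left(\frac{1}{\alpha_k^{BB1}}+\frac{\gamma_k}{\alpha_{k-2}}\right)\|g_{k-1}\|^2+\varsigma_k\|g_{k-2}\|^2,$$ where $$\varsigma_k=\left(\frac{\gamma_k-(1-\alpha_{k-2}\delta_k)}{\alpha_{k-2}^{BB1}}-\frac{\gamma_k}{\alpha_{k-2}}\right)\left(1-\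frac{\alpha_{k-2}}{\alpha_{k-1}^{BB1}}\right)-\frac{\gamma_k-(1-\alpha_{k-2}\delta_k)}{\alpha_{k-3}}\gamma_k(1-\sigma_k).$$
   Context: $g_k=\nabla f(x_k)=Ax_k-b$; $\alpha_k>0$ denotes the stepsize actually used in $x_{k+1}=x_k-\alpha_kg_k$; and $$\alpha_k^{BB1}=\frac{s_{k-1}^{\sf T}s_{k-1}}{s_{k-1}^{\sf T}y_{k-1}}=\frac{g_{k-1}^{\sf T}g_{k-1}}{g_{k-1}^{\sf T}Ag_{k-1}},\qquad s_{k-1}=x_k-x_{k-1},\ y_{k-1}=g_k-g_{k-1}.$$ The symbols $\alpha_k$ and $\alpha_k^{BB1}$ are kept apart because other stepsizes may be used at some iterations (e.g. the first). $\|\cdot\|$ is the Euclidean norm. The formulas are understood when the quotients in them are defined (in particular $\zeta_k\neq0$). *)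

theory Defs
  imports "HOL-Analysis.Analysis"
begin

definition sym_pos_def :: "real^'n^'n \<Rightarrow> bool" where
  "sym_pos_def A \<longleftrightarrow> transpose A = A \<and> (\<forall>x. x \<noteq> 0 \<longrightarrow> 0 < x \<bullet> (A *v x))"

definition quad_objective :: "real^'n^'n \<Rightarrow> real^'n \<Rightarrow> real^'n \<Rightarrow> real" where
  "quad_objective A b x = 1/2 * (x \<bullet> (A *v x)) - b \<bullet> x"

definition quad_gradient :: "real^'n^'n \<Rightarrow> real^'n \<Rightarrow> real^'n \<Rightarrow> real^'n" where
  "quad_gradient A b x = A *v x - b"

lemma gderiv_quad_objective:
  assumes "transpose A = A"
  shows "GDERIV (quad_objective A b) x :> quad_gradient A b x"
proof -
  have sym: "x \<bullet> (A *v h) = h \<bullet> (A *v x)" for h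
    by (metis assms dot_lmul_matrix inner_commute transpose_matrix_vector)
  have lin: "bounded_linear ((*v) A)"
    by (simp add: linear_conv_bounded_linear)
  have "((\<lambda>x. 1/2 * (x \<bullet> (A *v x)) - b \<bullet> x) has_derivative
          (\<lambda>h. 1/2 * (x \<bullet> (A *v h) + h \<bullet> (A *v x)) - b \<bullet> h)) (at x)"
    by (auto intro!: derivative_eq_intros bounded_linear.has_derivative[OF lin])
  moreover have "(\<lambda>h. 1/2 * (x \<bullet> (A *v h) + h \<bullet> (A *v x)) - b \<bullet> h)
      = (\<lambda>h. h \<bullet> quad_gradient A b x)"
    by (simp add: fun_eq_iff sym quad_gradient_def inner_diff_right inner_commute)
  ultimately show ?thesis
    unfolding gderiv_def quad_objective_def[abs_def] by simp
qed

(* The stepsizes alpha are arbitrary positive numbers: the method takes alpha j = bb1_stepsize A b x j,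
   but any iteration (the first one has to) may use another positive stepsize.  Only the first k
   steps are constrained, so nothing is assumed about what happens once the method has stopped. *)
definition gradient_steps ::
    "real^'n^'n \<Rightarrow> real^'n \<Rightarrow> (nat \<Rightarrow> real) \<Rightarrow> (nat \<Rightarrow> real^'n) \<Rightarrow> nat \<Rightarrow> bool" where
  "gradient_steps A b \<alpha> x k \<longleftrightarrow>
     (\<forall>j<k. 0 < \<alpha> j \<and> x (Suc j) = x j - \<alpha> j *\<^sub>R quad_gradient A b (x j))"

(* Meaningful for j \<ge> 1 only, because it looks back at the iterate j - 1. *)
definition bb1_stepsize ::
    "real^'n^'n \<Rightarrow> real^'n \<Rightarrow> (nat \<Rightarrow> real^'n) \<Rightarrow> nat \<Rightarrow> real" where
  "bb1_stepsize A b x j =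
     (let s = x j - x (j - 1);
          y = quad_gradient A b (x j) - quad_gradient A b (x (j - 1))
      in (s \<bullet> s) / (s \<bullet> y))"

lemma bb1_stepsize_gradient:
  assumes "1 \<le> j" and "gradient_steps A b \<alpha> x j"
  defines "g \<equiv> quad_gradient A b (x (j - 1))"
  shows "bb1_stepsize A b x j = (g \<bullet> g) / (g \<bullet> (A *v g))"
proof -
  obtain i where j: "j = Suc i" using assms(1) by (cases j) auto
  have a: "0 < \<alpha> i" and s: "x j - x (j - 1) = - \<alpha> i *\<^sub>R g"
    using assms(2) unfolding gradient_steps_def g_def j by auto
  have "quad_gradient A b (x j) - quad_gradient A b (x (j - 1)) = A *v (x j - x (j - 1))"
    by (simp add: quad_gradient_def matrix_vector_mult_diff_distrib)
  also have "\<dots> = - \<alpha> i *\<^sub>R (A *v g)"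
    by (simp only: s matrix_vector_mult_scaleR)
  finally show ?thesis
    using a unfolding bb1_stepsize_def Let_def s by simp
qed

end

theory Submission
  imports Defs
begin

text \<open>The identities \<open>A g\<^sub>j = (g\<^sub>j - g\<^sub>j\<^sub>+\<^sub>1) / \<alpha>\<^sub>j\<close> turn every application of \<open>A\<close> to the older gradients into
  a difference of gradients.  With \<open>p = g\<^sub>k\<^sub>-\<^sub>3\<close>, \<open>q = g\<^sub>k\<^sub>-\<^sub>2\<close>, \<open>w = g\<^sub>k\<^sub>-\<^sub>1\<close> the scalars of the statement become
  \<open>\<zeta> = p \<bullet> q / \<parallel>q\<parallel>\<^sup>2\<close>, \<open>\<sigma> = cos\<^sup>2 \<angle>(p, q)\<close>, \<open>\<delta> = q \<bullet> A p / p \<bullet> q\<close> and \<open>\<gamma> = w \<bullet> vbar / \<parallel>vbar\<parallel>\<^sup>2\<close>.  Orthogonality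
  in the Gram-Schmidt process then yields all entries; for instance \<open>A p\<close> lies in the span of \<open>p, q\<close>
  and is therefore orthogonal to \<open>rbar\<close>.\<close>

lemma symmetric_matrix_inner_commute:
  fixes A :: "real^'n^'n"
  assumes "transpose A = A"
  shows "x \<bullet> (A *v y) = y \<bullet> (A *v x)"
  by (metis assms dot_lmul_matrix inner_commute transpose_matrix_vector)

text \<open>Swapping the two sums gives the claim. The rows of \<open>V\<close> serve as basis
  vectors, so each entry of \<open>H\<close> becomes a value of the bilinear form of
  \<open>A\<close>.\<close>

lemma congruence_matrix_entry:
  fixes A :: "real^'n^'n" and V :: "real^'n^'m"
  shows "(V ** A ** transpose V) $ i $ j = V $ i \<bullet> (A *v (V $ j))"
proof -
  have "(V ** A ** transpose V) $ i $ j = (\<Sum>l\<in>UNIV. (\<Sum>m\<in>UNIV. V $ i $ m * A $ m $ l) * V $ j $ l)"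
    by (simp add: matrix_matrix_mult_def transpose_def)
  also have "\<dots> = (\<Sum>m\<in>UNIV. \<Sum>l\<in>UNIV. V $ i $ m * A $ m $ l * V $ j $ l)"
    unfolding sum_distrib_right by (rule sum.swap)
  also have "\<dots> = V $ i \<bullet> (A *v (V $ j))"
    by (simp add: inner_vec_def matrix_vector_mult_def sum_distrib_left mult.assoc)
  finally show ?thesis .
qed

lemma quad_gradient_step:
  assumes "gradient_steps A b \<alpha> x k" and "j < k"
  shows "quad_gradient A b (x (Suc j))
       = quad_gradient A b (x j) - \<alpha> j *\<^sub>R (A *v quad_gradient A b (x j))"
  using assms
  by (simp add: gradient_steps_def quad_gradient_def matrix_vector_mult_diff_distrib
      matrix_vector_mult_scaleR)

text \<open>The reciprocal of a BB stepsize is a Rayleigh quotient of \<open>A\<close>. Its index is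
  one ahead of that of the gradient, since the stepsize looks back one iterate.\<close>

lemma inverse_bb1_stepsize:
  assumes "gradient_steps A b \<alpha> x k" and "j < k"
  defines "g \<equiv> quad_gradient A b (x j)"
  shows "1 / bb1_stepsize A b x (Suc j) = (g \<bullet> (A *v g)) / (g \<bullet> g)"
proof -
  have "gradient_steps A b \<alpha> x (Suc j)"
    using assms by (auto simp: gradient_steps_def)
  from bb1_stepsize_gradient[OF _ this] show ?thesis
    by (simp add: g_def)
qed

text \<open>No vector lies in the span of those listed after it, so the coefficients may be
  arbitrary and orthogonality does not enter. Distinctness excludes a repeated vector, which the set
  notation would hide.\<close>

lemma gram_schmidt_nonzero:
  fixes p q w :: "'a::real_inner"
  assumes "distinct [w, q, p]" and "independent {w, q, p}"
  shows "p \<noteq> 0" and "q - s *\<^sub>R p \<noteq> 0" and "w - t *\<^sub>R p - c *\<^sub>R (q - s *\<^sub>R p) \<noteq> 0"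
proof -
  have w: "w \<notin> span {q, p}" and qp: "independent {q, p}"
    using assms by (auto simp: independent_insert)
  then have q: "q \<notin> span {p}" and p: "independent {p}"
    using assms(1) by (auto simp: independent_insert)
  show "p \<noteq> 0"
    using p by auto
  show "q - s *\<^sub>R p \<noteq> 0"
  proof
    assume "q - s *\<^sub>R p = 0"
    then have "q = s *\<^sub>R p" by simp
    then show False
      using q by (metis insertI1 span_base span_scale)
  qed
  show "w - t *\<^sub>R p - c *\<^sub>R (q - s *\<^sub>R p) \<noteq> 0"
  proof
    assume "w - t *\<^sub>R p - c *\<^sub>R (q - s *\<^sub>R p) = 0"
    then have "w = t *\<^sub>R p + c *\<^sub>R (q - s *\<^sub>R p)"
      by (simp add: algebra_simps)
    moreover have "t *\<^sub>R p + c *\<^sub>R (q - s *\<^sub>R p) \<in> span {q, p}"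
      by (intro span_add span_diff span_scale span_base) auto
    ultimately show False
      using w by simp
  qed
qed

theorem corollary3p1:
  fixes A :: "real^'n^'n" and b :: "real^'n"
    and x g :: "nat \<Rightarrow> real^'n" and \<alpha> \<alpha>BB :: "nat \<Rightarrow> real" and k :: nat
    and vbar rbar u v r :: "real^'n" and U :: "real^3^'n" and H :: "real^3^3"
    and \<zeta> \<sigma> \<delta> \<gamma> \<tau> h12 h22 h23 h33 :: real
  assumes "sym_pos_def A"
    and "3 \<le> k"
    and "gradient_steps A b \<alpha> x k"
    and "g = (\<lambda>j. quad_gradient A b (x j))"
    and "\<alpha>BB = bb1_stepsize A b x"
    and "distinct [g (k-1), g (k-2), g (k-3)]"
    and "independent {g (k-1), g (k-2), g (k-3)}"
    and "vbar = g (k-2) - ((g (k-2) \<bullet> g (k-3)) / (norm (g (k-3)))\<^sup>2) *\<^sub>R g (k-3)"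
    and "rbar = g (k-1) - ((g (k-1) \<bullet> g (k-3)) / (norm (g (k-3)))\<^sup>2) *\<^sub>R g (k-3)
                  - ((g (k-1) \<bullet> vbar) / (norm vbar)\<^sup>2) *\<^sub>R vbar"
    and "u = (1 / norm (g (k-3))) *\<^sub>R g (k-3)"
    and "v = (1 / norm vbar) *\<^sub>R vbar"
    and "r = (1 / norm rbar) *\<^sub>R rbar"
    and "U = transpose (vector [u, v, r])"
    and "H = transpose U ** A ** U"
    and "\<zeta> = (1 - \<alpha> (k-3) / \<alpha>BB (k-2)) * ((norm (g (k-3)))\<^sup>2 / (norm (g (k-2)))\<^sup>2)"
    and "\<zeta> \<noteq> 0"
    and "\<sigma> = (1 - \<alpha> (k-3) / \<alpha>BB (k-2)) * \<zeta>"
    and "\<delta> = 1 / \<alpha> (k-3) * (1 - 1 / \<zeta>)"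
    and "\<gamma> = 1 - \<alpha> (k-2) / (1 - \<sigma>) * (1 / \<alpha>BB (k-1) - \<sigma> * \<delta>)"
    and "\<tau> = ((\<gamma> - (1 - \<alpha> (k-2) * \<delta>)) / \<alpha>BB (k-2) - \<gamma> / \<alpha> (k-2)) * (1 - \<alpha> (k-2) / \<alpha>BB (k-1))
               - (\<gamma> - (1 - \<alpha> (k-2) * \<delta>)) / \<alpha> (k-3) * \<gamma> * (1 - \<sigma>)"
    and "h12 = - (sqrt (1 - \<sigma>) * norm (g (k-2)) / (\<alpha> (k-3) * norm (g (k-3))))"
    and "h22 = 1 / (1 - \<sigma>) * (1 / \<alpha>BB (k-1) - 2 * \<sigma> * \<delta> + \<sigma> / \<alpha>BB (k-2))"
    and "h23 = - (sqrt (g (k-1) \<bullet> rbar) / (\<alpha> (k-2) * norm (g (k-2)) * sqrt (1 - \<sigma>)))"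
    and "h33 = (g (k-1) \<bullet> (A *v rbar)) / (g (k-1) \<bullet> rbar) + \<gamma> / \<alpha> (k-2)"
  shows "H = vector [vector [1 / \<alpha>BB (k-2), h12, 0],
                     vector [h12,            h22, h23],
                     vector [0,              h23, h33]]
    \<and> g (k-1) \<bullet> rbar = (norm (g (k-1)))\<^sup>2
          - (\<sigma> * (1 - \<alpha> (k-2) * \<delta>)\<^sup>2 + \<gamma>\<^sup>2 * (1 - \<sigma>)) * (norm (g (k-2)))\<^sup>2
    \<and> g (k-1) \<bullet> (A *v rbar) = (1 / \<alpha>BB k + \<gamma> / \<alpha> (k-2)) * (norm (g (k-1)))\<^sup>2
          + \<tau> * (norm (g (k-2)))\<^sup>2"
proof -

  \<comment> \<open>Notation and the gradient recurrences\<close>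
  have sym: "transpose A = A"
    using assms(1) by (simp add: sym_pos_def_def)
  note A_commute = symmetric_matrix_inner_commute[OF sym]
  define p q w a c where "p = g (k-3)" and "q = g (k-2)" and "w = g (k-1)"
    and "a = \<alpha> (k-3)" and "c = \<alpha> (k-2)"
  note names = p_def[symmetric] q_def[symmetric] w_def[symmetric] a_def[symmetric] c_def[symmetric]
  \<comment> \<open>The numbers \<open>\<beta>1\<close>, \<open>\<beta>2\<close>,
    \<open>\<beta>3\<close> are the Rayleigh quotients of \<open>A\<close> at \<open>p\<close>,
    \<open>q\<close>, \<open>w\<close>.\<close>
  define P Q W \<beta>1 \<beta>2 \<beta>3 where "P = p \<bullet> p" and "Q = q \<bullet> q" and "W = w \<bullet> w"
    and "\<beta>1 = 1 / \<alpha>BB (k-2)" and "\<beta>2 = 1 / \<alpha>BB (k-1)" and "\<beta>3 = 1 / \<alpha>BB k"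
  have idx: "Suc (k-3) = k-2" "Suc (k-2) = k-1" "Suc (k-1) = k" "k-3 < k" "k-2 < k" "k-1 < k"
    using assms(2) by auto
  have a: "a > 0" and c: "c > 0"
    using assms(3) idx unfolding gradient_steps_def a_def c_def by auto
  have q_eq: "q = p - a *\<^sub>R (A *v p)" and w_eq: "w = q - c *\<^sub>R (A *v q)"
    using quad_gradient_step[OF assms(3) idx(4)] quad_gradient_step[OF assms(3) idx(5)]
    by (simp_all add: idx(1,2) p_def q_def w_def a_def c_def assms(4))
  have Ap: "A *v p = (1 / a) *\<^sub>R (p - q)" and Aq: "A *v q = (1 / c) *\<^sub>R (q - w)"
    using a c by (simp_all add: q_eq w_eq)
  have \<beta>: "\<beta>1 = (p \<bullet> (A *v p)) / P" "\<beta>2 = (q \<bullet> (A *v q)) / Q" "\<beta>3 = (w \<bullet> (A *v w)) / W"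
    using inverse_bb1_stepsize[OF assms(3) idx(4)] inverse_bb1_stepsize[OF assms(3) idx(5)]
      inverse_bb1_stepsize[OF assms(3) idx(6)]
    unfolding idx(1-3) p_def q_def w_def P_def Q_def W_def \<beta>1_def \<beta>2_def \<beta>3_def assms(4,5)
    by blast+

  define s where "s = (p \<bullet> q) / P"
  have vbar: "vbar = q - s *\<^sub>R p"
    using assms(8) unfolding names by (simp add: s_def P_def power2_norm_eq_inner inner_commute)
  define t where "t = (w \<bullet> p) / P"
  define d where "d = (w \<bullet> vbar) / (vbar \<bullet> vbar)"
  have rbar: "rbar = w - t *\<^sub>R p - d *\<^sub>R vbar"
    using assms(9) unfolding names by (simp add: t_def d_def P_def power2_norm_eq_inner)
  have nz: "distinct [w, q, p]" "independent {w, q, p}"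
    using assms(6,7) unfolding names by simp_all
  have p0: "p \<noteq> 0" and v0: "vbar \<noteq> 0" and r0: "rbar \<noteq> 0"
    using gram_schmidt_nonzero[OF nz] by (simp_all add: vbar rbar)
  have q0: "q \<noteq> 0" and w0: "w \<noteq> 0"
    using nz(2) dependent_zero[of "{w, q, p}"] by auto
  have pos: "P > 0" "Q > 0" "W > 0" "vbar \<bullet> vbar > 0" "rbar \<bullet> rbar > 0"
    using p0 q0 w0 v0 r0 by (simp_all add: P_def Q_def W_def)
  have norms: "(norm p)\<^sup>2 = P" "(norm q)\<^sup>2 = Q" "(norm w)\<^sup>2 = W"
    by (simp_all add: P_def Q_def W_def power2_norm_eq_inner)

  \<comment> \<open>Orthogonality in the Gram-Schmidt process\<close>
  have p_v: "p \<bullet> vbar = 0"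
    using pos(1) by (simp add: vbar s_def P_def inner_diff_right)
  have v_v: "vbar \<bullet> vbar = q \<bullet> vbar"
    using p_v by (subst (1) vbar) (simp add: inner_diff_left)
  have p_r: "p \<bullet> rbar = 0"
    using pos(1) p_v by (simp add: rbar t_def P_def inner_diff_right inner_commute)
  have v_r: "vbar \<bullet> rbar = 0"
    using pos(4) p_v by (simp add: rbar d_def inner_diff_right inner_commute)
  have q_r: "q \<bullet> rbar = 0"
    using v_r p_r by (simp add: vbar inner_diff_left)
  have r_r: "rbar \<bullet> rbar = w \<bullet> rbar"
    using p_r v_r by (subst (1) rbar) (simp add: inner_diff_left)

  \<comment> \<open>The scalars of the statement as inner products\<close>
  have s: "s = 1 - a * \<beta>1"
    using pos(1) a by (simp add: s_def \<beta> Ap P_def inner_diff_right field_simps)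
  \<comment> \<open>Pairing \<open>q = p - a *\<^sub>R (A *v p)\<close> with \<open>p\<close> has
    shown that the factor common to \<zeta> and \<sigma> is the Gram-Schmidt coefficient
    \<open>s\<close>.\<close>
  have s_BB: "1 - a / \<alpha>BB (k-2) = s"
    by (simp add: s \<beta>1_def)
  have \<zeta>: "\<zeta> = (p \<bullet> q) / Q"
    using assms(15) pos(1) unfolding names norms s_BB by (simp add: s_def)
  \<comment> \<open>Nonvanishing of \<zeta> means that \<open>p\<close> and \<open>q\<close> are not
    orthogonal, so the quotient defining \<delta> is genuine.\<close>
  have pq0: "p \<bullet> q \<noteq> 0"
    using assms(16) \<zeta> by auto
  have \<sigma>: "\<sigma> = s * (p \<bullet> q) / Q"
    using assms(17) unfolding names s_BB by (simp add: \<zeta>)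
  have \<delta>: "\<delta> = (p \<bullet> q - Q) / (a * (p \<bullet> q))"
    using assms(18) pq0 a pos(2) unfolding names \<zeta> by (simp add: field_simps)
  have qAp: "q \<bullet> (A *v p) = \<delta> * (p \<bullet> q)"
    using a pq0 by (simp add: \<delta> Ap Q_def inner_diff_right inner_commute)
  \<comment> \<open>Pythagoras: \<open>1 - \<sigma>\<close> is the squared sine of the angle between
    \<open>p\<close> and \<open>q\<close>. It is positive because \<open>vbar\<close> is
    nonzero.\<close>
  have v_v_\<sigma>: "vbar \<bullet> vbar = Q * (1 - \<sigma>)"
    unfolding v_v using pos(2) by (simp add: vbar \<sigma> inner_diff_right Q_def inner_commute field_simps)
  then have \<sigma>1: "1 - \<sigma> > 0"
    using pos(2,4) by (simp add: zero_less_mult_iff)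
  have w_q: "w \<bullet> q = Q * (1 - c * \<beta>2)"
    using pos(2) by (subst w_eq) (simp add: \<beta> Q_def inner_diff_left inner_commute[of "A *v q"] right_diff_distrib)
  have w_p: "w \<bullet> p = (p \<bullet> q) * (1 - c * \<delta>)"
    using qAp A_commute[of p q]
    by (subst w_eq) (simp add: inner_diff_left inner_commute[of q p] inner_commute[of "A *v q" p] algebra_simps)
  have t: "t = s * (1 - c * \<delta>)"
    by (simp add: t_def w_p s_def)
  \<comment> \<open>This is the squared length of the projection of \<open>q\<close> onto
    \<open>p\<close>. Later terms keep the product grouped so that it can be replaced by
    \<open>\<sigma> * Q\<close>.\<close>
  have s_pq: "s * (p \<bullet> q) = \<sigma> * Q"
    using pos(2) by (simp add: \<sigma>)
  have w_v_eq: "w \<bullet> vbar = w \<bullet> q - s * (w \<bullet> p)"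
    by (simp add: vbar inner_diff_right)
  have "w \<bullet> vbar = Q * (1 - c * \<beta>2) - (s * (p \<bullet> q)) * (1 - c * \<delta>)"
    unfolding w_v_eq w_q w_p by simp
  also have "\<dots> = Q * ((1 - \<sigma>) - c * (\<beta>2 - \<sigma> * \<delta>))"
    unfolding s_pq by (simp add: algebra_simps)
  also have "(1 - \<sigma>) - c * (\<beta>2 - \<sigma> * \<delta>) = (1 - \<sigma>) * \<gamma>"
    using assms(19) \<sigma>1 unfolding names \<beta>2_def[symmetric] by (simp add: field_simps)
  finally have w_v: "w \<bullet> vbar = \<gamma> * (Q * (1 - \<sigma>))"
    by simp
  have d: "d = \<gamma>"
    using pos(2) \<sigma>1 unfolding d_def w_v v_v_\<sigma> by simp

  \<comment> \<open>The inner products of \<open>w\<close> with \<open>rbar\<close> and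
    \<open>A *v rbar\<close>\<close>
  have w_r: "w \<bullet> rbar = W - (\<sigma> * (1 - c * \<delta>)\<^sup>2 + \<gamma>\<^sup>2 * (1 - \<sigma>)) * Q"
  proof -
    have "w \<bullet> rbar = W - t * (w \<bullet> p) - \<gamma> * (w \<bullet> vbar)"
      by (simp add: rbar d W_def inner_diff_right)
    also have "t * (w \<bullet> p) = (s * (p \<bullet> q)) * (1 - c * \<delta>)\<^sup>2"
      unfolding t w_p by (simp add: power2_eq_square)
    finally show ?thesis
      unfolding s_pq w_v by (simp add: algebra_simps power2_eq_square)
  qed

  \<comment> \<open>Expanding \<open>vbar\<close> gives \<open>rbar = w - \<gamma> *\<^sub>R q +
    (\<epsilon> * s) *\<^sub>R p\<close>, so \<epsilon> collects both contributions of
    \<open>p\<close>.\<close>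
  define \<epsilon> where "\<epsilon> = \<gamma> - (1 - c * \<delta>)"
  have \<tau>: "\<tau> = (\<epsilon> * \<beta>1 - \<gamma> / c) * (1 - c * \<beta>2) - \<epsilon> / a * \<gamma> * (1 - \<sigma>)"
    using assms(20) unfolding names \<epsilon>_def \<beta>1_def \<beta>2_def by simp
  have wAr: "w \<bullet> (A *v rbar) = (\<beta>3 + \<gamma> / c) * W + \<tau> * Q"
  proof -
    have "w \<bullet> (A *v rbar) = w \<bullet> (A *v w) - t * (w \<bullet> (A *v p))
        - \<gamma> * (w \<bullet> (A *v q) - s * (w \<bullet> (A *v p)))"
      by (simp add: rbar d vbar matrix_vector_mult_diff_distrib matrix_vector_mult_scaleR
          inner_diff_right)
    also have "\<dots> = w \<bullet> (A *v w) - \<gamma> * (w \<bullet> (A *v q)) + \<epsilon> * (s * (w \<bullet> (A *v p)))"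
      by (simp add: t \<epsilon>_def algebra_simps)
    also have "w \<bullet> (A *v w) = \<beta>3 * W"
      using pos(3) by (simp add: \<beta>)
    also have "w \<bullet> (A *v q) = (Q * (1 - c * \<beta>2) - W) / c"
      by (simp add: Aq inner_diff_right w_q W_def)
    also have "s * (w \<bullet> (A *v p)) = \<beta>1 * (Q * (1 - c * \<beta>2)) - \<gamma> * (Q * (1 - \<sigma>)) / a"
    proof -
      have "s * (w \<bullet> (A *v p)) = (s * (w \<bullet> p) - s * (w \<bullet> q)) / a"
        by (simp add: Ap inner_diff_right right_diff_distrib diff_divide_distrib)
      \<comment> \<open>Eliminating \<open>w \<bullet> p\<close> through
        \<open>w \<bullet> vbar\<close> leaves \<open>w \<bullet> q\<close> with the factor
        \<open>(1 - s) / a\<close>, which is \<open>\<beta>1\<close>.\<close>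
      also have "s * (w \<bullet> p) = w \<bullet> q - \<gamma> * (Q * (1 - \<sigma>))"
        using w_v_eq w_v by simp
      also have "(w \<bullet> q - \<gamma> * (Q * (1 - \<sigma>)) - s * (w \<bullet> q)) / a
          = \<beta>1 * (w \<bullet> q) - \<gamma> * (Q * (1 - \<sigma>)) / a"
        using a by (simp add: s field_simps)
      finally show ?thesis
        by (simp add: w_q)
    qed
    finally show ?thesis
      unfolding \<tau> using c by (simp add: algebra_simps diff_divide_distrib add_divide_distrib)
  qed

  \<comment> \<open>The bilinear form of \<open>A\<close> on the unnormalized vectors\<close>
  have pAv: "p \<bullet> (A *v vbar) = - ((vbar \<bullet> vbar) / a)"
    unfolding A_commute[of p] Ap v_v using p_v
    by (simp add: inner_diff_right inner_commute)
  have pAr: "p \<bullet> (A *v rbar) = 0"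
    unfolding A_commute[of p] Ap using p_r q_r
    by (simp add: inner_diff_right inner_commute)
  \<comment> \<open>Moving \<open>A\<close> onto \<open>q\<close> leaves a combination of
    \<open>q\<close> and \<open>w\<close>, of which only \<open>w\<close> meets \<open>rbar\<close>.
    Replacing \<open>q\<close> by \<open>vbar\<close> afterwards changes nothing, since they differ
    by a multiple of \<open>p\<close>.\<close>
  have qAr: "q \<bullet> (A *v rbar) = - ((rbar \<bullet> rbar) / c)"
    unfolding A_commute[of q] Aq r_r using q_r
    by (simp add: inner_diff_right inner_commute)
  have vAr: "vbar \<bullet> (A *v rbar) = - ((rbar \<bullet> rbar) / c)"
    using qAr pAr by (simp add: vbar inner_diff_left)
  \<comment> \<open>Only the left factor is expanded: its \<open>p\<close> part vanishes and its
    \<open>vbar\<close> part yields the \<gamma> term.\<close>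
  have rAr: "rbar \<bullet> (A *v rbar) = w \<bullet> (A *v rbar) + \<gamma> * (rbar \<bullet> rbar) / c"
    using pAr vAr by (subst (1) rbar) (simp add: d inner_diff_left)
  have vAv: "vbar \<bullet> (A *v vbar) = Q * (\<beta>2 - 2 * \<sigma> * \<delta> + \<sigma> * \<beta>1)"
  proof -
    have "vbar \<bullet> (A *v vbar) = q \<bullet> (A *v q) - 2 * (s * (q \<bullet> (A *v p))) + s * s * (p \<bullet> (A *v p))"
      using A_commute[of p q]
      by (simp add: vbar matrix_vector_mult_diff_distrib matrix_vector_mult_scaleR
          inner_diff_right inner_diff_left algebra_simps)
    also have "s * (q \<bullet> (A *v p)) = (s * (p \<bullet> q)) * \<delta>"
      by (simp add: qAp)
    also have "s * s * (p \<bullet> (A *v p)) = (s * (p \<bullet> q)) * \<beta>1"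
      by (simp add: \<beta> s_def)
    also have "q \<bullet> (A *v q) = \<beta>2 * Q"
      using pos(2) by (simp add: \<beta>)
    finally show ?thesis
      unfolding s_pq by (simp add: algebra_simps)
  qed

  \<comment> \<open>Normalization and the individual entries\<close>
  have nv: "norm vbar = norm q * sqrt (1 - \<sigma>)"
    unfolding norm_eq_sqrt_inner[of vbar] v_v_\<sigma>
    by (simp add: real_sqrt_mult Q_def norm_eq_sqrt_inner)
  have nr: "norm rbar = sqrt (w \<bullet> rbar)"
    unfolding norm_eq_sqrt_inner[of rbar] r_r ..
  have sq: "vbar \<bullet> vbar = norm vbar * norm vbar" "rbar \<bullet> rbar = norm rbar * norm rbar"
    by (simp_all add: norm_eq_sqrt_inner)
  have e11: "u \<bullet> (A *v u) = \<beta>1"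
    unfolding assms(10) names
    by (simp add: matrix_vector_mult_scaleR \<beta> P_def norm_eq_sqrt_inner)
  have e12: "u \<bullet> (A *v v) = h12"
  proof -
    have "u \<bullet> (A *v v) = - (norm vbar / (a * norm p))"
      unfolding assms(10,11) names using v0
      by (simp add: matrix_vector_mult_scaleR pAv sq)
    then show ?thesis
      unfolding assms(21) names nv by (simp add: mult.commute)
  qed
  have e13: "u \<bullet> (A *v r) = 0"
    unfolding assms(10,12) names by (simp add: matrix_vector_mult_scaleR pAr)
  have e22: "v \<bullet> (A *v v) = h22"
  proof -
    have "v \<bullet> (A *v v) = (vbar \<bullet> (A *v vbar)) / (vbar \<bullet> vbar)"
      unfolding assms(11) by (simp add: matrix_vector_mult_scaleR sq)
    also have "\<dots> = (\<beta>2 - 2 * \<sigma> * \<delta> + \<sigma> * \<beta>1) / (1 - \<sigma>)"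
      unfolding vAv v_v_\<sigma> using pos(2) by simp
    finally show ?thesis
      unfolding assms(22) \<beta>1_def \<beta>2_def by simp
  qed
  have e23: "v \<bullet> (A *v r) = h23"
  proof -
    have "v \<bullet> (A *v r) = - (norm rbar / (c * norm vbar))"
      unfolding assms(11,12) using r0
      by (simp add: matrix_vector_mult_scaleR vAr sq)
    then show ?thesis
      unfolding assms(23) names nv nr by (simp add: mult.assoc)
  qed
  have e33: "r \<bullet> (A *v r) = h33"
  proof -
    have "r \<bullet> (A *v r) = (rbar \<bullet> (A *v rbar)) / (rbar \<bullet> rbar)"
      unfolding assms(12) by (simp add: matrix_vector_mult_scaleR sq)
    also have "\<dots> = (w \<bullet> (A *v rbar)) / (rbar \<bullet> rbar) + \<gamma> / c"
      unfolding rAr using pos(5) by (simp add: add_divide_distrib)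
    finally show ?thesis
      unfolding assms(24) names r_r .
  qed

  \<comment> \<open>Assembly of the matrix\<close>
  have "H = vector [u, v, r] ** A ** transpose (vector [u, v, r])"
    unfolding assms(14) assms(13) transpose_transpose ..
  then have entry: "H $ i $ j = vector [u, v, r] $ i \<bullet> (A *v (vector [u, v, r] $ j))" for i j
    by (simp add: congruence_matrix_entry)
  \<comment> \<open>Symmetry of \<open>A\<close> supplies the entries below the diagonal from those
    above it.\<close>
  have "H = vector [vector [\<beta>1, h12, 0], vector [h12, h22, h23], vector [0, h23, h33]]"
    unfolding vec_eq_iff forall_3 entry vector_3
    by (simp add: e11 e12 e13 e22 e23 e33 A_commute[of v u] A_commute[of r u] A_commute[of r v])
  then show ?thesis
    using w_r wAr unfolding names norms \<beta>1_def \<beta>3_def by blast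
qed

end
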